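(* Let $h:\mathbb R\to\mathbb R$ be $1$-periodic and continuous. Suppose that there exist $\alpha\in(0,1]$ and a nonempty open set $U\subset\mathbb S^1$ such that $h|_U\in C^\alpha(U,\mathbb R)$. Then $$\limsup_{t\to\infty}\left(t^{1/\alpha}\sup_{m\in\mathbb Z}\left|\int_0^1 e^{ith(\theta)}e^{-2i\pi m\theta}\,d\theta\right|\right)>0.$$
   Context: $\mathbb S^1=\mathbb R/\mathbb Z$, and $1$-periodic functions are identified with functions on $\mathbb S^1$. $C^\alpha(U,\mathbb R)$, $\alpha\in(0,1]$, denotes functions satisfying a Hölder condition of exponent $\alpha$ on $U$ (Lipschitz if $\alpha=1$). *)

theory Defs
  imports "HOL-Analysis.Analysis"
begin

definition int_shift :: "real \<Rightarrow> real \<Rightarrow> bool" where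
  "int_shift x y \<longleftrightarrow> x - y \<in> \<int>"

quotient_type circle = real / int_shift
proof (rule equivpI)
  show "reflp int_shift" by (simp add: reflp_def int_shift_def)
  show "symp int_shift" unfolding symp_def int_shift_def
    by (metis Ints_minus minus_diff_eq)
  show "transp int_shift" unfolding transp_def int_shift_def
    by (metis Ints_add diff_add_cancel add_diff_eq)
qed

lift_definition to_circle :: "real \<Rightarrow> circle" is "\<lambda>x. x" .

lemma to_circle_eq_iff: "to_circle x = to_circle y \<longleftrightarrow> x - y \<in> \<int>"
  by transfer (simp add: int_shift_def)

lemma to_circle_surj: "\<exists>x. p = to_circle x"
  by transfer (metis int_shift_def diff_self Ints_0)

instantiation circle :: metric_space
begin

definition dist_circle :: "circle \<Rightarrow> circle \<Rightarrow> real" where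
  "dist_circle p q = setdist (to_circle -` {p}) (to_circle -` {q})"

definition uniformity_circle :: "(circle \<times> circle) filter" where
  "uniformity_circle = (INF e\<in>{0<..}. principal {(p, q). dist p q < e})"

definition open_circle :: "circle set \<Rightarrow> bool" where
  "open_circle U \<longleftrightarrow> (\<forall>p\<in>U. eventually (\<lambda>(p', q). p' = p \<longrightarrow> q \<in> U) uniformity)"

lemma dist_to_circle_round:
  "dist (to_circle x) (to_circle y) = \<bar>x - y - of_int (round (x - y))\<bar>"
proof -
  let ?A = "to_circle -` {to_circle x}" and ?B = "to_circle -` {to_circle y}"
  have "setdist ?A ?B \<le> dist x (y + of_int (round (x - y)))"
    by (rule setdist_le_dist) (auto simp: to_circle_eq_iff)
  moreover have "\<bar>x - y - of_int (round (x - y))\<bar> \<le> setdist ?A ?B"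
  proof (rule le_setdistI)
    fix a b assume "a \<in> ?A" "b \<in> ?B"
    then have "a - x \<in> \<int>" "b - y \<in> \<int>" by (auto simp: to_circle_eq_iff)
    then have "(b - y) - (a - x) \<in> \<int>" by (rule Ints_diff[rotated])
    then obtain m where "(b - y) - (a - x) = of_int m" by (elim Ints_cases)
    then have "dist a b = \<bar>x - y - of_int m\<bar>" by (simp add: dist_real_def)
    then show "\<bar>x - y - of_int (round (x - y))\<bar> \<le> dist a b"
      using round_diff_minimal[of "x - y" m] by simp
  qed auto
  ultimately show ?thesis
    by (simp add: dist_circle_def dist_real_def diff_diff_eq)
qed

instance
proof
  fix p q r :: circle
  obtain x y z where *: "p = to_circle x" "q = to_circle y" "r = to_circle z"
    using to_circle_surj by metis
  show "dist p q = 0 \<longleftrightarrow> p = q"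
  proof
    assume "dist p q = 0"
    then have "x - y = of_int (round (x - y))" by (simp add: * dist_to_circle_round)
    then have "x - y \<in> \<int>" by (metis Ints_of_int)
    then show "p = q" by (simp add: * to_circle_eq_iff)
  qed (simp add: * dist_to_circle_round)
  show "dist p q \<le> dist p r + dist q r"
  proof -
    have "\<bar>x - y - of_int (round (x - y))\<bar>
        \<le> \<bar>x - y - of_int (round (x - z) - round (y - z))\<bar>"
      by (rule round_diff_minimal)
    then show ?thesis by (simp add: * dist_to_circle_round)
  qed
qed (simp_all add: uniformity_circle_def open_circle_def)

end

text \<open>The metric topology is the quotient topology of the real line modulo the integers.\<close>

lemma open_circle_iff: "open U \<longleftrightarrow> open (to_circle -` U)"
proof
  assume U: "open U"
  show "open (to_circle -` U)"
    unfolding open_dist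
  proof
    fix x assume "x \<in> to_circle -` U"
    with U obtain e where e: "e > 0" "\<And>q. dist q (to_circle x) < e \<Longrightarrow> q \<in> U"
      by (auto simp: open_dist)
    have "dist (to_circle y) (to_circle x) \<le> dist y x" for y
      using round_diff_minimal[of "y - x" 0] by (simp add: dist_to_circle_round dist_real_def)
    with e show "\<exists>e>0. \<forall>y. dist y x < e \<longrightarrow> y \<in> to_circle -` U"
      by (meson le_less_trans vimageI2)
  qed
next
  assume U: "open (to_circle -` U)"
  show "open U"
    unfolding open_dist
  proof
    fix p assume "p \<in> U"
    obtain x where p: "p = to_circle x" using to_circle_surj by blast
    with \<open>p \<in> U\<close> have "x \<in> to_circle -` U" by simp
    with U obtain e where e: "e > 0" "\<And>y. dist y x < e \<Longrightarrow> to_circle y \<in> U"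
      unfolding open_dist by blast
    have "q \<in> U" if "dist q p < e" for q
    proof -
      obtain y where q: "q = to_circle y" using to_circle_surj by blast
      have "to_circle (y - of_int (round (y - x))) \<in> U"
        using that by (intro e(2)) (simp add: p q dist_to_circle_round dist_real_def algebra_simps)
      also have "to_circle (y - of_int (round (y - x))) = q"
        by (simp add: q to_circle_eq_iff)
      finally show ?thesis .
    qed
    with e(1) show "\<exists>e>0. \<forall>q. dist q p < e \<longrightarrow> q \<in> U" by blast
  qed
qed

text \<open>The function on the circle identified with a 1-periodic function on the real line;
  for functions that are not 1-periodic it depends on the choice of representatives.\<close>

definition circle_fun :: "(real \<Rightarrow> 'a) \<Rightarrow> circle \<Rightarrow> 'a" where
  "circle_fun f p = f (rep_circle p)"

lemma to_circle_rep_circle: "to_circle (rep_circle p) = p"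
  by (metis Quotient3_abs_rep Quotient3_circle to_circle.abs_eq)

lemma circle_fun_to_circle:
  fixes f :: "real \<Rightarrow> 'a"
  assumes "\<And>x. f (x + 1) = f x"
  shows "circle_fun f (to_circle x) = f x"
proof -
  have nat: "f (y + of_nat n) = f y" for y n
  proof (induction n)
    case (Suc n)
    then show ?case using assms[of "y + of_nat n"] by (simp add: add_ac)
  qed simp
  have "rep_circle (to_circle x) - x \<in> \<int>"
    using to_circle_rep_circle[of "to_circle x"] by (simp add: to_circle_eq_iff)
  then obtain k where k: "rep_circle (to_circle x) = x + of_int k"
    by (metis Ints_cases add.commute diff_add_cancel)
  show ?thesis
  proof (cases k)
    case (nonneg n)
    then show ?thesis using k nat[of x n] by (simp add: circle_fun_def)
  next
    case (neg n)
    then have "x = rep_circle (to_circle x) + of_nat (Suc n)" using k by simp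
    then show ?thesis using nat[of "rep_circle (to_circle x)" "Suc n"]
      by (simp add: circle_fun_def)
  qed
qed

definition holder_on :: "real \<Rightarrow> 'a::metric_space set \<Rightarrow> ('a \<Rightarrow> 'b::metric_space) \<Rightarrow> bool" where
  "holder_on \<alpha> U f \<longleftrightarrow> (\<exists>C. \<forall>x\<in>U. \<forall>y\<in>U. dist (f x) (f y) \<le> C * dist x y powr \<alpha>)"

end

theory Submission
  imports Defs "HOL-Real_Asymp.Real_Asymp"
begin

text \<open>
  The reason for the lower bound is the uncertainty principle. Fix a point \<open>c\<close> over \<open>U\<close>. On the
  arc of radius \<open>2 / N\<close> around \<open>c\<close> the phase \<open>t * h\<close> varies by at most \<open>t * K * (2 / N) powr \<alpha>\<close> if \<open>K\<close>
  is a Hoelder constant of \<open>h\<close> on \<open>U\<close> and \<open>N\<close> is large. So for \<open>t\<close> of order \<open>N powr \<alpha>\<close> with a small constant the function \<open>exp (\<i> * t * h)\<close> is within \<open>1 / 4\<close> of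
  its value at \<open>c\<close> there. Averaging it against a probability density concentrated on that arc
  therefore gives a number of modulus bounded below. If that density is a trigonometric polynomial
  whose coefficients have absolute sum at most \<open>N\<close>, the same average is at most \<open>N\<close> times the largest
  Fourier coefficient, which is thus at least a constant times \<open>1 / N\<close>, that is, a constant
  times \<open>t powr (- 1 / \<alpha>)\<close>.

  The density is the normalised square modulus of a polynomial of degree less than \<open>N\<close> with
  coefficients \<open>sin (j * pi / N)\<close>. These coefficients are the first Dirichlet eigenvector of the
  discrete Laplacian, so the mean of \<open>1 - cos (2 * pi * (\<theta> - c))\<close> is exactly \<open>1 - cos (pi / N)\<close>
  (lemma \<open>has_integral_sine_kernel_cos\<close>), which is of order \<open>1 / N\<^sup>2\<close>. A Chebyshev
  argument then controls the mass outside the arc without any pointwise estimate of the kernel.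
  Both halves meet in \<open>Fourier_coefficient_bound_if_nearly_constant\<close>.
\<close>

section \<open>A positive trigonometric polynomial of minimal variance\<close>

text \<open>
  Since \<open>sin ((j + 1) * x) + sin ((j - 1) * x) = 2 * cos x * sin (j * x)\<close>, the difference of the two
  sums telescopes. The boundary term vanishes for \<open>x = pi / n\<close>.
\<close>

lemma sum_sin_mult_sin_Suc:
  fixes x :: real
  shows "(\<Sum>j<n. sin (real j * x) * sin (real (Suc j) * x))
           = cos x * (\<Sum>j<n. (sin (real j * x))\<^sup>2)
             + sin (real n * x) * sin ((real n - 1) * x) / 2"
proof (induction n)
  case (Suc n)
  have "sin ((real n + 1) * x) + sin ((real n - 1) * x) = 2 * cos x * sin (real n * x)"
    by (simp add: ring_distribs sin_add sin_diff)
  then have "sin (real n * x) * sin ((real n - 1) * x)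
      = 2 * cos x * (sin (real n * x))\<^sup>2 - sin (real n * x) * sin ((real n + 1) * x)"
    by (simp add: power2_eq_square algebra_simps flip: distrib_left)
  then show ?case
    using Suc by (simp add: algebra_simps)
qed simp

definition sine_kernel :: "nat \<Rightarrow> real \<Rightarrow> real" where
  "sine_kernel N y = (cmod (\<Sum>j<N. of_real (sin (real j * (pi / N))) * cis (2 * pi * real j * y)))\<^sup>2"

definition sine_mass :: "nat \<Rightarrow> real" where
  "sine_mass N = (\<Sum>j<N. (sin (real j * (pi / N)))\<^sup>2)"

lemma sine_kernel_nonneg: "sine_kernel N y \<ge> 0"
  by (simp add: sine_kernel_def)

lemma continuous_on_sine_kernel [continuous_intros]:
  "continuous_on A f \<Longrightarrow> continuous_on A (\<lambda>y. sine_kernel N (f y))"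
  unfolding sine_kernel_def by (intro continuous_intros)

lemma sine_mass_pos:
  assumes "N \<ge> 2"
  shows "sine_mass N > 0"
  unfolding sine_mass_def
proof (rule sum_pos2[of _ 1])
  have "sin (pi / N) > 0"
    using assms by (intro sin_gt_zero) (auto simp: field_simps)
  then show "0 < (sin (real 1 * (pi / N)))\<^sup>2" by simp
qed (use assms in auto)

lemma sine_kernel_eq_sum:
  "complex_of_real (sine_kernel N y) =
     (\<Sum>j<N. \<Sum>k<N. of_real (sin (real j * (pi / N)) * sin (real k * (pi / N)))
                 * cis (2 * pi * of_int (int j - int k) * y))"
  unfolding sine_kernel_def complex_norm_square cnj_sum sum_product
  by (intro sum.cong refl)
     (simp add: cis_mult cis_cnj algebra_simps flip: of_real_mult)

lemma has_integral_cis_int: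
  "((\<lambda>\<theta>. cis (2 * pi * of_int n * (\<theta> - c))) has_integral (if n = 0 then 1 else 0)) {0..1}"
proof (cases "n = 0")
  case True
  then show ?thesis using has_integral_const_real[of "1::complex" 0 1] by simp
next
  case False
  define G where "G z = exp (\<i> * (2 * pi * of_int n) * (z - of_real c)) / (\<i> * (2 * pi * of_int n))" for z
  have cis_eq: "cis (2 * pi * of_int n * (\<theta> - c)) = exp (\<i> * (2 * pi * of_int n) * (of_real \<theta> - of_real c))" for \<theta>
    by (simp add: cis_conv_exp algebra_simps)
  have "(G has_field_derivative exp (\<i> * (2 * pi * of_int n) * (z - of_real c))) (at z)" for z
    unfolding G_def using False by (auto intro!: derivative_eq_intros)
  then have "((\<lambda>\<theta>. cis (2 * pi * of_int n * (\<theta> - c))) has_integral (G (of_real 1) - G (of_real 0))) {0..1}"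
    unfolding cis_eq by (intro fundamental_theorem_of_calculus has_vector_derivative_real_field) auto
  moreover have "cis (2 * pi * of_int n * (1 - c)) = cis (2 * pi * of_int n * (0 - c))"
  proof -
    have "cis (2 * pi * of_int n * (1 - c)) = cis (2 * pi * of_int n) * cis (2 * pi * of_int n * (0 - c))"
      by (simp add: cis_mult algebra_simps)
    then show ?thesis by simp
  qed
  ultimately show ?thesis using False by (simp only: G_def flip: cis_eq) simp
qed

lemma has_integral_sine_kernel:
  "((\<lambda>\<theta>. sine_kernel N (\<theta> - c)) has_integral sine_mass N) {0..1}"
proof -
  have "((\<lambda>\<theta>. complex_of_real (sine_kernel N (\<theta> - c))) has_integral
      (\<Sum>j<N. \<Sum>k<N. of_real (sin (real j * (pi / N)) * sin (real k * (pi / N)))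
         * (if int j - int k = 0 then 1 else 0))) {0..1}"
    unfolding sine_kernel_eq_sum
    by (intro has_integral_sum has_integral_mult_right has_integral_cis_int finite_lessThan)
  also have "(\<Sum>j<N. \<Sum>k<N. complex_of_real (sin (real j * (pi / N)) * sin (real k * (pi / N)))
         * (if int j - int k = 0 then 1 else 0)) = of_real (sine_mass N)"
    by (simp add: sine_mass_def if_distrib power2_eq_square cong: if_cong)
  finally show ?thesis
    by (drule_tac has_integral_linear[OF _ bounded_linear_Re]) (simp add: o_def)
qed

text \<open>
  Multiplying by \<open>cis (2 * pi * (\<theta> - c))\<close> shifts the frequencies by one, so that the integral picks out
  the products of consecutive coefficients.
\<close>

lemma has_integral_sine_kernel_cos:
  "((\<lambda>\<theta>. sine_kernel N (\<theta> - c) * cos (2 * pi * (\<theta> - c))) has_integral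
      cos (pi / N) * sine_mass N) {0..1}"
proof -
  let ?a = "\<lambda>j. sin (real j * (pi / N))"
  have "((\<lambda>\<theta>. complex_of_real (sine_kernel N (\<theta> - c)) * cis (2 * pi * (\<theta> - c))) has_integral
      (\<Sum>j<N. \<Sum>k<N. of_real (?a j * ?a k) * (if int j - int k + 1 = 0 then 1 else 0))) {0..1}"
    unfolding sine_kernel_eq_sum sum_distrib_right mult.assoc
    apply (intro has_integral_sum has_integral_mult_right finite_lessThan)
    subgoal for j k
      using has_integral_cis_int[of "int j - int k + 1" c]
      by (simp add: cis_mult algebra_simps)
    done
  also have "(\<Sum>j<N. \<Sum>k<N. complex_of_real (?a j * ?a k) * (if int j - int k + 1 = 0 then 1 else 0))
      = of_real (\<Sum>j<N. ?a j * ?a (Suc j))"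
  proof -
    have "(\<Sum>k<N. complex_of_real (?a j * ?a k) * (if int j - int k + 1 = 0 then 1 else 0))
        = of_real (?a j * ?a (Suc j))" if "j < N" for j
    proof -
      have "(int j - int k + 1 = 0) = (Suc j = k)" for k by auto
      \<comment> \<open>The coefficient after the last one is \<open>sin pi\<close>, so the sum may run up to \<open>j = N - 1\<close>.\<close>
      moreover have "?a (Suc j) = 0" if "\<not> Suc j < N"
      proof -
        have "Suc j = N" using that \<open>j < N\<close> by simp
        then show ?thesis using \<open>j < N\<close> by auto
      qed
      ultimately show ?thesis
        by (cases "Suc j < N") (auto simp: if_distrib cong: if_cong)
    qed
    then show ?thesis by (simp only: of_real_sum) (intro sum.cong refl, auto)
  qed
  also have "(\<Sum>j<N. ?a j * ?a (Suc j)) = cos (pi / N) * sine_mass N"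
    using sum_sin_mult_sin_Suc[of "pi / real N" N] by (cases "N = 0") (auto simp: sine_mass_def)
  finally show ?thesis
    by (drule_tac has_integral_linear[OF _ bounded_linear_Re]) (simp add: o_def)
qed

section \<open>Large Fourier coefficients of functions that are locally nearly constant\<close>

text \<open>
  The Fourier coefficients of the kernel have absolute sum at most the square of the sum of the
  sines, and the Cauchy--Schwarz inequality compares this with the mass at the cost of a factor \<open>N\<close>.
\<close>

lemma norm_integral_sine_kernel_le:
  fixes f :: "real \<Rightarrow> complex"
  assumes f: "continuous_on {0..1} f"
    and B: "\<And>m::int. cmod (integral {0..1}
              (\<lambda>\<theta>. f \<theta> * exp (- 2 * \<i> * of_real pi * of_int m * of_real \<theta>))) \<le> B"
  shows "cmod (integral {0..1} (\<lambda>\<theta>. of_real (sine_kernel N (\<theta> - c)) * f \<theta>))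
           \<le> real N * sine_mass N * B"
proof -
  let ?a = "\<lambda>j. sin (real j * (pi / N))"
  have a0: "?a j \<ge> 0" if "j < N" for j
    using that by (intro sin_ge_zero) (auto simp: field_simps)
  have B0: "B \<ge> 0" using B[of 0] norm_ge_zero order_trans by blast
  define I where "I n = integral {0..1} (\<lambda>\<theta>. cis (2 * pi * of_int n * (\<theta> - c)) * f \<theta>)" for n :: int
  have I: "cmod (I n) \<le> B" for n
  proof -
    have *: "cis (2 * pi * of_int n * (\<theta> - c)) * f \<theta> = cis (- (2 * pi * of_int n * c))
        * (f \<theta> * exp (- 2 * \<i> * of_real pi * of_int (- n) * of_real \<theta>))" for \<theta>
    proof -
      have "exp (- 2 * \<i> * of_real pi * of_int (- n) * of_real \<theta>) = cis (2 * pi * of_int n * \<theta>)"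
        by (simp add: cis_conv_exp algebra_simps)
      moreover have "cis (2 * pi * of_int n * (\<theta> - c))
          = cis (- (2 * pi * of_int n * c)) * cis (2 * pi * of_int n * \<theta>)"
        by (simp add: cis_mult algebra_simps)
      ultimately show ?thesis by (simp only: mult_ac)
    qed
    show ?thesis
      unfolding I_def * integral_mult_right norm_mult norm_cis using B[of "- n"] by simp
  qed
  have "((\<lambda>\<theta>. of_real (sine_kernel N (\<theta> - c)) * f \<theta>) has_integral
      (\<Sum>j<N. \<Sum>k<N. of_real (?a j * ?a k) * I (int j - int k))) {0..1}"
    unfolding sine_kernel_eq_sum sum_distrib_right mult.assoc I_def
    by (intro has_integral_sum has_integral_mult_right finite_lessThan
          integrable_integral integrable_continuous_real continuous_intros f)
  then have "integral {0..1} (\<lambda>\<theta>. of_real (sine_kernel N (\<theta> - c)) * f \<theta>)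
      = (\<Sum>j<N. \<Sum>k<N. of_real (?a j * ?a k) * I (int j - int k))"
    by (rule integral_unique)
  also have "cmod \<dots> \<le> (\<Sum>j<N. \<Sum>k<N. ?a j * ?a k * B)"
    using I a0 by (intro sum_norm_le) (auto simp: norm_mult mult_left_mono)
  also have "\<dots> = (\<Sum>j<N. ?a j)\<^sup>2 * B"
    unfolding power2_eq_square sum_product by (simp only: sum_distrib_right)
  also have "(\<Sum>j<N. ?a j)\<^sup>2 \<le> real N * sine_mass N"
    using Cauchy_Schwarz_ineq_sum[of "\<lambda>_. 1" ?a "{..<N}"] by (simp add: sine_mass_def)
  finally show ?thesis using B0 by (simp add: mult_right_mono)
qed

text \<open>
  Doubling the angle at least doubles \<open>1 - cos\<close> as long as the cosine is nonnegative, because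
  \<open>1 - cos (2 * x) = 2 * (1 - cos x) * (1 + cos x)\<close>.
\<close>

lemma one_minus_cos_quadruple_ge:
  fixes x :: real
  assumes "0 \<le> x" "x \<le> pi / 4"
  shows "1 - cos (4 * x) \<ge> 4 * (1 - cos x)"
proof -
  have c: "cos x \<ge> 0" "cos (2 * x) \<ge> 0"
    using assms by (auto intro!: cos_ge_zero)
  have "2 * (1 - cos x) \<le> 2 * (1 - cos x) * (1 + cos x)"
    using mult_nonneg_nonneg[of "1 - cos x" "cos x"] c by (simp add: algebra_simps)
  also have "\<dots> = 1 - cos (2 * x)"
    using cos_double_cos[of x] by (simp add: power2_eq_square algebra_simps)
  finally have 1: "2 * (1 - cos x) \<le> 1 - cos (2 * x)" .
  have "2 * (1 - cos (2 * x)) \<le> 2 * (1 - cos (2 * x)) * (1 + cos (2 * x))"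
    using mult_nonneg_nonneg[of "1 - cos (2 * x)" "cos (2 * x)"] c by (simp add: algebra_simps)
  also have "\<dots> = 1 - cos (4 * x)"
    using cos_double_cos[of "2 * x"] by (simp add: power2_eq_square algebra_simps)
  finally have 2: "2 * (1 - cos (2 * x)) \<le> 1 - cos (4 * x)" .
  have "4 * (1 - cos x) = 2 * (2 * (1 - cos x))" by simp
  also have "\<dots> \<le> 2 * (1 - cos (2 * x))" using 1 by (intro mult_left_mono) auto
  finally show ?thesis using 2 by (rule order_trans)
qed

text \<open>
  The closeness condition describes the arc of radius \<open>2 / N\<close> modulo 1 around \<open>c\<close>. On that
  arc \<open>f\<close> differs from \<open>w\<close> by at most \<open>1 / 4\<close>; the complement contributes at most \<open>1 / 2\<close> to the
  weighted mean of \<open>f - w\<close>, since there the trivial bound \<open>2\<close> is dominated by a multiple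
  of \<open>1 - cos (2 * pi * (\<theta> - c))\<close> whose weighted mean is \<open>1 / 2\<close>. This leaves \<open>1 / 4\<close> for the modulus
  of the weighted mean of \<open>f\<close>.
\<close>

lemma Fourier_coefficient_bound_if_nearly_constant:
  fixes f :: "real \<Rightarrow> complex"
  assumes N: "N \<ge> 4"
    and f: "continuous_on {0..1} f"
    and f1: "\<And>\<theta>. cmod (f \<theta>) \<le> 1" and w: "cmod w = 1"
    and near: "\<And>\<theta>. cos (2 * pi * (\<theta> - c)) > cos (4 * (pi / N)) \<Longrightarrow> cmod (f \<theta> - w) \<le> 1 / 4"
    and B: "\<And>m::int. cmod (integral {0..1}
              (\<lambda>\<theta>. f \<theta> * exp (- 2 * \<i> * of_real pi * of_int m * of_real \<theta>))) \<le> B"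
  shows "1 / 4 \<le> real N * B"
proof -
  let ?S = "sine_mass N" and ?P = "\<lambda>\<theta>. sine_kernel N (\<theta> - c)"
  define v where "v = 1 - cos (pi / N)"
  have S: "?S > 0" using N by (intro sine_mass_pos) auto
  have v: "v > 0"
    using N cos_monotone_0_pi[of 0 "pi / N"] by (simp add: v_def field_simps)
  have v4: "1 - cos (4 * (pi / N)) \<ge> 4 * v"
    unfolding v_def using N by (intro one_minus_cos_quadruple_ge) (auto simp: field_simps)
  have pt: "cmod (f \<theta> - w) \<le> 1 / 4 + (1 - cos (2 * pi * (\<theta> - c))) / (2 * v)" for \<theta>
  proof (cases "cos (2 * pi * (\<theta> - c)) > cos (4 * (pi / N))")
    case True
    have "0 \<le> (1 - cos (2 * pi * (\<theta> - c))) / (2 * v)" using v by simp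
    with near[OF True] show ?thesis by linarith
  next
    case False
    have "cmod (f \<theta> - w) \<le> 2" using norm_triangle_ineq4[of "f \<theta>" w] f1[of \<theta>] w by simp
    also have "2 \<le> (1 - cos (2 * pi * (\<theta> - c))) / (2 * v)"
      using False v v4 by (simp add: field_simps)
    finally show ?thesis by simp
  qed
  have P: "(?P has_integral ?S) {0..1}" by (rule has_integral_sine_kernel)
  have Pc: "((\<lambda>\<theta>. of_real (?P \<theta>) * w) has_integral (of_real ?S * w)) {0..1}"
    using has_integral_linear[OF P bounded_linear_of_real]
    by (intro has_integral_mult_left) (simp add: o_def)
  have Pf: "(\<lambda>\<theta>. of_real (?P \<theta>) * f \<theta>) integrable_on {0..1}"
    by (intro integrable_continuous_real continuous_intros f)
  define g where "g = (\<lambda>\<theta>. ?P \<theta> * (1 / 4 + (1 - cos (2 * pi * (\<theta> - c))) / (2 * v)))"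
  have "((\<lambda>\<theta>. (1 / 4 + 1 / (2 * v)) * ?P \<theta> - 1 / (2 * v) * (?P \<theta> * cos (2 * pi * (\<theta> - c))))
      has_integral ((1 / 4 + 1 / (2 * v)) * ?S - 1 / (2 * v) * (cos (pi / N) * ?S))) {0..1}"
    by (intro has_integral_diff has_integral_mult_right P has_integral_sine_kernel_cos)
  also have "(\<lambda>\<theta>. (1 / 4 + 1 / (2 * v)) * ?P \<theta> - 1 / (2 * v) * (?P \<theta> * cos (2 * pi * (\<theta> - c)))) = g"
    using v by (auto simp: g_def field_simps)
  also have "(1 / 4 + 1 / (2 * v)) * ?S - 1 / (2 * v) * (cos (pi / N) * ?S)
      = 1 / 4 * ?S + v / (2 * v) * ?S"
    unfolding v_def by (simp add: algebra_simps diff_divide_distrib)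
  also have "\<dots> = 3 / 4 * ?S" using v by simp
  finally have g: "(g has_integral (3 / 4 * ?S)) {0..1}" .
  have "integral {0..1} (\<lambda>\<theta>. of_real (?P \<theta>) * f \<theta>) - of_real ?S * w
      = integral {0..1} (\<lambda>\<theta>. of_real (?P \<theta>) * f \<theta> - of_real (?P \<theta>) * w)"
    by (subst integral_diff[OF Pf has_integral_integrable[OF Pc]])
       (simp only: integral_unique[OF Pc])
  also have "cmod \<dots> \<le> integral {0..1} g"
  proof (rule integral_norm_bound_integral)
    show "(\<lambda>\<theta>. of_real (?P \<theta>) * f \<theta> - of_real (?P \<theta>) * w) integrable_on {0..1}"
      using Pf Pc by (intro integrable_diff) auto
    show "g integrable_on {0..1}" using g by auto
    show "cmod (of_real (?P \<theta>) * f \<theta> - of_real (?P \<theta>) * w) \<le> g \<theta>" for \<theta>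
      using pt[of \<theta>] sine_kernel_nonneg[of N "\<theta> - c"]
      by (simp add: g_def norm_mult mult_left_mono flip: right_diff_distrib)
  qed
  also have "\<dots> = 3 / 4 * ?S" using g by (rule integral_unique)
  finally have "cmod (of_real ?S * w)
      - cmod (integral {0..1} (\<lambda>\<theta>. of_real (?P \<theta>) * f \<theta>)) \<le> 3 / 4 * ?S"
    by (smt (verit) norm_minus_commute norm_triangle_ineq2)
  then have "?S / 4 \<le> cmod (integral {0..1} (\<lambda>\<theta>. of_real (?P \<theta>) * f \<theta>))"
    using S w by (simp add: norm_mult)
  also have "\<dots> \<le> real N * ?S * B"
    by (rule norm_integral_sine_kernel_le[OF f B])
  finally have "?S * (1 / 4) \<le> ?S * (real N * B)" by (simp add: algebra_simps)
  then show ?thesis using S by simp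
qed

section \<open>Oscillating exponentials with a locally Hoelder phase\<close>

lemma norm_exp_i_diff_le:
  fixes s t :: real
  shows "cmod (exp (\<i> * of_real s) - exp (\<i> * of_real t)) \<le> \<bar>s - t\<bar>"
proof -
  have "exp (\<i> * of_real s) - exp (\<i> * of_real t)
      = exp (\<i> * of_real t) * (exp (\<i> * of_real (s - t)) - 1)"
    by (simp add: right_diff_distrib exp_diff exp_not_eq_zero)
  moreover have "cmod (exp (\<i> * of_real (s - t)) - 1) \<le> \<bar>s - t\<bar>"
    using dist_exp_i_1[of "s - t"] abs_sin_x_le_abs_x[of "(s - t) / 2"] by simp
  ultimately show ?thesis by (simp add: norm_mult)
qed

lemma dist_to_circle_less_if_cos_greater:
  assumes "cos (2 * pi * (x - y)) > cos (2 * pi * r)" and "0 \<le> r"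
  shows "dist (to_circle x) (to_circle y) < r"
proof (rule ccontr)
  define d where "d = dist (to_circle x) (to_circle y)"
  assume "\<not> dist (to_circle x) (to_circle y) < r"
  then have r: "r \<le> d" by (simp add: d_def)
  define k where "k = round (x - y)"
  have d: "d = \<bar>x - y - of_int k\<bar>" by (simp add: d_def k_def dist_to_circle_round)
  have "d \<le> 1 / 2"
    using of_int_round_abs_le[of "x - y"] by (simp add: d k_def abs_minus_commute)
  then have "cos (2 * pi * d) \<le> cos (2 * pi * r)"
    using r assms(2) by (intro cos_monotone_0_pi_le) auto
  moreover have "cos (2 * pi * d) = cos (2 * pi * (x - y - of_int k))"
    by (cases "x - y - of_int k \<ge> 0") (auto simp: d abs_if algebra_simps cos_diff)
  moreover have "\<dots> = cos (2 * pi * (x - y))"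
    by (simp add: right_diff_distrib cos_diff)
  ultimately show False using assms(1) by linarith
qed

theorem proposition3p3:
  fixes h :: "real \<Rightarrow> real" and \<alpha> :: real and U :: "circle set"
  assumes "\<And>x. h (x + 1) = h x"
    and "continuous_on UNIV h"
    and "0 < \<alpha>" and "\<alpha> \<le> 1"
    and "open U" and "U \<noteq> {}"
    and "holder_on \<alpha> U (circle_fun h)"
  shows "Limsup at_top (\<lambda>t::real. ereal (t powr (1 / \<alpha>)) *
           (SUP m::int. ereal (cmod (integral {0..1} (\<lambda>\<theta>::real.
              exp (\<i> * of_real t * of_real (h \<theta>)) *
              exp (- 2 * \<i> * of_real pi * of_int m * of_real \<theta>)))))) > 0"
proof -
  define F where "F t m = cmod (integral {0..1} (\<lambda>\<theta>::real. exp (\<i> * of_real t * of_real (h \<theta>)) *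
      exp (- 2 * \<i> * of_real pi * of_int m * of_real \<theta>)))" for t :: real and m :: int
  obtain c where c: "to_circle c \<in> U" using \<open>U \<noteq> {}\<close> to_circle_surj by (metis ex_in_conv)
  then obtain \<rho> where \<rho>: "\<rho> > 0" "\<And>p. dist p (to_circle c) < \<rho> \<Longrightarrow> p \<in> U"
    using \<open>open U\<close> unfolding open_dist by blast
  obtain C where C: "\<And>p q. p \<in> U \<Longrightarrow> q \<in> U \<Longrightarrow>
      dist (circle_fun h p) (circle_fun h q) \<le> C * dist p q powr \<alpha>"
    using assms(7) unfolding holder_on_def by blast
  \<comment> \<open>The constant \<open>C\<close> may be zero or negative; a positive one is needed to divide by it.\<close>
  define K where "K = max C 1"
  have K: "K > 0" "C \<le> K" by (auto simp: K_def)
  have holder: "\<bar>h \<theta> - h c\<bar> \<le> K * dist (to_circle \<theta>) (to_circle c) powr \<alpha>"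
    if "dist (to_circle \<theta>) (to_circle c) < \<rho>" for \<theta>
  proof -
    have "\<bar>h \<theta> - h c\<bar> \<le> C * dist (to_circle \<theta>) (to_circle c) powr \<alpha>"
      using C[OF \<rho>(2)[OF that] c] by (simp add: circle_fun_to_circle assms(1) dist_real_def)
    also have "\<dots> \<le> K * dist (to_circle \<theta>) (to_circle c) powr \<alpha>"
      using K by (intro mult_right_mono) auto
    finally show ?thesis .
  qed
  \<comment> \<open>The time at which the phase varies by exactly \<open>1 / 4\<close> in the worst case on the arc of
    radius \<open>2 / N\<close>.\<close>
  define \<tau> where "\<tau> N = (real N / 2) powr \<alpha> / (4 * K)" for N :: nat
  \<comment> \<open>Chosen so that \<open>\<tau> N powr (1 / \<alpha>) / (4 * N) = \<kappa>\<close>.\<close>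
  define \<kappa> where "\<kappa> = (1 / (4 * K)) powr (1 / \<alpha>) / 8"
  have \<kappa>: "\<kappa> > 0" using K by (simp add: \<kappa>_def)
  have bound: "1 / (4 * real N) \<le> B"
    if N: "N \<ge> 4" "2 / real N < \<rho>" and B: "\<And>m. F (\<tau> N) m \<le> B" for N B
  proof -
    let ?f = "\<lambda>\<theta>. exp (\<i> * of_real (\<tau> N) * of_real (h \<theta>))"
    have \<tau>0: "\<tau> N \<ge> 0" using K by (simp add: \<tau>_def)
    have "1 / 4 \<le> real N * B"
    proof (rule Fourier_coefficient_bound_if_nearly_constant[OF N(1)])
      show "continuous_on {0..1} ?f"
        by (intro continuous_intros continuous_on_subset[OF assms(2)]) auto
      show "cmod (?f \<theta>) \<le> 1" for \<theta> by simp
      show "cmod (?f c) = 1" by simp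
      show "cmod (?f \<theta> - ?f c) \<le> 1 / 4"
        if "cos (2 * pi * (\<theta> - c)) > cos (4 * (pi / real N))" for \<theta>
      proof -
        have d: "dist (to_circle \<theta>) (to_circle c) < 2 / real N"
          by (rule dist_to_circle_less_if_cos_greater) (use that in \<open>simp_all add: mult.commute\<close>)
        have "cmod (?f \<theta> - ?f c) \<le> \<bar>\<tau> N * h \<theta> - \<tau> N * h c\<bar>"
          using norm_exp_i_diff_le[of "\<tau> N * h \<theta>" "\<tau> N * h c"] by (simp add: mult.assoc)
        also have "\<dots> = \<tau> N * \<bar>h \<theta> - h c\<bar>"
          using \<tau>0 by (simp add: abs_mult flip: right_diff_distrib)
        also have "\<dots> \<le> \<tau> N * (K * (2 / real N) powr \<alpha>)"
        proof -
          have "dist (to_circle \<theta>) (to_circle c) powr \<alpha> \<le> (2 / real N) powr \<alpha>"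
            using d assms(3) by (intro powr_mono2) auto
          then have "K * dist (to_circle \<theta>) (to_circle c) powr \<alpha> \<le> K * (2 / real N) powr \<alpha>"
            using K by simp
          then show ?thesis
            using holder[of \<theta>] d N(2) \<tau>0 by (intro mult_left_mono) linarith+
        qed
        also have "\<dots> = 1 / 4"
          using K N(1) by (simp add: \<tau>_def powr_divide)
        finally show ?thesis .
      qed
      show "cmod (integral {0..1} (\<lambda>\<theta>. ?f \<theta> * exp (- 2 * \<i> * of_real pi * of_int m * of_real \<theta>))) \<le> B"
        for m using B[of m] by (simp add: F_def)
    qed
    then show ?thesis using N(1) by (simp add: field_simps)
  qed
  have large: "ereal \<kappa> \<le> ereal (\<tau> N powr (1 / \<alpha>)) * (SUP m. ereal (F (\<tau> N) m))"
    if N: "N \<ge> 4" "2 / real N < \<rho>" for N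
  proof -
    have "ereal (1 / (4 * real N)) \<le> (SUP m. ereal (F (\<tau> N) m))"
    proof (rule ccontr)
      assume "\<not> ?thesis"
      then obtain B where B: "(SUP m. ereal (F (\<tau> N) m)) < ereal B" "ereal B < ereal (1 / (4 * real N))"
        by (meson ereal_dense2 not_le)
      have "F (\<tau> N) m \<le> B" for m
        using B(1) SUP_lessD[OF B(1), of m] by auto
      then show False using bound[OF N, of B] B(2) by simp
    qed
    then have "ereal (\<tau> N powr (1 / \<alpha>)) * ereal (1 / (4 * real N))
        \<le> ereal (\<tau> N powr (1 / \<alpha>)) * (SUP m. ereal (F (\<tau> N) m))"
      by (intro ereal_mult_left_mono) auto
    also have "\<tau> N powr (1 / \<alpha>) = real N / 2 * (1 / (4 * K)) powr (1 / \<alpha>)"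
    proof -
      have "\<tau> N = (real N / 2) powr \<alpha> * (1 / (4 * K))" by (simp add: \<tau>_def)
      then show ?thesis using K assms(3)
        by (simp only: powr_mult powr_powr) simp
    qed
    also have "ereal (real N / 2 * (1 / (4 * K)) powr (1 / \<alpha>)) * ereal (1 / (4 * real N)) = ereal \<kappa>"
      using N(1) by (simp add: \<kappa>_def)
    finally show ?thesis by (simp only: \<open>\<tau> N powr (1 / \<alpha>) = _\<close>)
  qed
  have \<tau>_lim: "filterlim \<tau> at_top sequentially"
    unfolding \<tau>_def using K assms(3) by real_asymp
  have "ereal \<kappa> \<le> Limsup at_top (\<lambda>t. ereal (t powr (1 / \<alpha>)) * (SUP m. ereal (F t m)))"
  proof (rule ccontr)
    assume "\<not> ?thesis"
    then have "\<forall>\<^sub>F t in at_top. ereal (t powr (1 / \<alpha>)) * (SUP m. ereal (F t m)) < ereal \<kappa>"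
      by (intro Limsup_lessD) (auto simp: not_le)
    then have "\<forall>\<^sub>F N in sequentially. 
        ereal (\<tau> N powr (1 / \<alpha>)) * (SUP m. ereal (F (\<tau> N) m)) < ereal \<kappa>"
      by (rule eventually_compose_filterlim[OF _ \<tau>_lim])
    moreover have "\<forall>\<^sub>F N in sequentially. 2 / real N < \<rho>"
      using \<rho>(1) by (intro order_tendstoD(2)[OF lim_const_over_n])
    moreover have "\<forall>\<^sub>F N in sequentially. 4 \<le> N" by (rule eventually_ge_at_top)
    ultimately have "\<forall>\<^sub>F N::nat in sequentially. False"
      by eventually_elim (use large in \<open>auto simp: not_le[symmetric]\<close>)
    then show False by simp
  qed
  with \<kappa> show ?thesis unfolding F_def
    by (meson ereal_less(2) less_le_trans)
qed

end
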